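(* Let $n\in\mathbb{N}$ be such that a finite field $\mathbb{F}$ of size $n$ exists, let $\mathcal{F}$ be the set of all functions $[n]\to[n]$, let $\mathsf{Inv}=(\mathsf{Pre},\mathsf{Qry},\mathsf{Dec})$ be an $s$-advice non-adaptive inverter with an affine decoder, and let $\tau\in[0,1]$. Then for every $\delta\in[0,1]$ and every integer $m\le n/16$, $$\Pr_{f\leftarrow\mathcal{F}}\Big[\Pr_{x\leftarrow[n],\,y=f(x)}\big[\mathsf{Inv}(y;f)\in f^{-1}(y)\big]\ge\tau\Big]\le \alpha_{\tau,\delta}+2^s\cdot\delta^{-m}\cdot\prod_{j=1}^{m}\left(\frac{2j}{n}+\max\Big\{\sqrt[4]{1/n},\ \frac{4j}{n}\Big\}\right),$$ where $\alpha_{\tau,\delta}:=\Pr_{f\leftarrow\mathcal{F}}\big[\exists\,\mathcal{X}\subseteq[n]\text{ with }|\mathcal{X}|\ge\tau n\text{ and }|f(\mathcal{X})|\le\delta n\big]$.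
   Context: $[n]=\{1,\dots,n\}$; $f(\mathcal{X})=\{f(x):x\in\mathcal{X}\}$; $f^{-1}(y)=\{x:f(x)=y\}$; $f\leftarrow\mathcal{F}$, $x\leftarrow[n]$ uniform. The elements of $\mathbb{F}$ are identified with $[n]$ via a fixed bijection, $f$ is identified with $(f(1),\dots,f(n))\in\mathbb{F}^n$, and $\langle u,w\rangle=\sum_iu_iw_i$ over $\mathbb{F}$. An $s$-advice, $q$-query non-adaptive inverter is a triple of deterministic functions $\mathsf{Pre}:\mathcal{F}\to\{0,1\}^s$, $\mathsf{Qry}:[n]\times\{0,1\}^s\to[n]^q$, $\mathsf{Dec}:[n]\times\{0,1\}^s\times[n]^q\to[n]$, with $\mathsf{Inv}(y;f):=\mathsf{Dec}(y,a,f(\mathsf{Qry}(y,a)))$ for $a=\mathsf{Pre}(f)$, where $f(v_1,\dots,v_q)=(f(v_1),\dots,f(v_q))$. It has an affine decoder if for every $y\in[n]$, $a\in\{0,1\}^s$ there exist $\alpha^a_y\in\mathbb{F}^n$ with at most $q$ nonzero entries and $\beta^a_y\in\mathbb{F}$ such that $\mathsf{Dec}(y,a,f(\mathsf{Qry}(y,a)))=\langle\alpha^a_y,f\rangle+\beta^a_y$ for all $f\in\mathcal{F}$. *)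

theory Defs
  imports "HOL-Probability.Probability"
begin

text \<open>
  The index set $[n]$ is \<open>{1..n}\<close>. Functions on it are taken extensional, so that the set
  below has exactly $n^n$ elements.
\<close>

definition funs :: "nat \<Rightarrow> (nat \<Rightarrow> nat) set" where
  "funs n = {1..n} \<rightarrow>\<^sub>E {1..n}"

definition advice :: "nat \<Rightarrow> bool list set" where
  "advice s = {a. length a = s}"

definition tuples :: "nat \<Rightarrow> nat \<Rightarrow> nat list set" where
  "tuples n q = {v. length v = q \<and> set v \<subseteq> {1..n}}"

definition preimage_of :: "nat \<Rightarrow> (nat \<Rightarrow> nat) \<Rightarrow> nat \<Rightarrow> nat set" where
  "preimage_of n f y = {x \<in> {1..n}. f x = y}"

definition nonadaptive_inverter ::
  "nat \<Rightarrow> nat \<Rightarrow> nat \<Rightarrow> ((nat \<Rightarrow> nat) \<Rightarrow> bool list) \<Rightarrow> (nat \<Rightarrow> bool list \<Rightarrow> nat list)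
    \<Rightarrow> (nat \<Rightarrow> bool list \<Rightarrow> nat list \<Rightarrow> nat) \<Rightarrow> bool" where
  "nonadaptive_inverter n s q Pre Qry Dec \<longleftrightarrow>
     (\<forall>f\<in>funs n. Pre f \<in> advice s) \<and>
     (\<forall>y\<in>{1..n}. \<forall>a\<in>advice s. Qry y a \<in> tuples n q) \<and>
     (\<forall>y\<in>{1..n}. \<forall>a\<in>advice s. \<forall>v\<in>tuples n q. Dec y a v \<in> {1..n})"

definition Inv ::
  "((nat \<Rightarrow> nat) \<Rightarrow> bool list) \<Rightarrow> (nat \<Rightarrow> bool list \<Rightarrow> nat list)
    \<Rightarrow> (nat \<Rightarrow> bool list \<Rightarrow> nat list \<Rightarrow> nat) \<Rightarrow> nat \<Rightarrow> (nat \<Rightarrow> nat) \<Rightarrow> nat" where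
  "Inv Pre Qry Dec y f = (let a = Pre f in Dec y a (map f (Qry y a)))"

text \<open>
  The parameter \<open>\<phi>\<close> is the fixed bijection from \<open>{1..n}\<close> to the field; it identifies \<open>f\<close> with the
  vector whose \<open>i\<close>-th entry is \<open>\<phi> (f i)\<close>. Vectors over the field are functions on \<open>nat\<close>, of which
  only the values on \<open>{1..n}\<close> matter.
\<close>

definition affine_decoder ::
  "nat \<Rightarrow> nat \<Rightarrow> nat \<Rightarrow> (nat \<Rightarrow> 'k::field) \<Rightarrow> (nat \<Rightarrow> bool list \<Rightarrow> nat list)
    \<Rightarrow> (nat \<Rightarrow> bool list \<Rightarrow> nat list \<Rightarrow> nat) \<Rightarrow> bool" where
  "affine_decoder n s q \<phi> Qry Dec \<longleftrightarrow>
     (\<forall>y\<in>{1..n}. \<forall>a\<in>advice s. \<exists>(\<alpha> :: nat \<Rightarrow> 'k) (\<beta> :: 'k).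
        card {i \<in> {1..n}. \<alpha> i \<noteq> 0} \<le> q \<and>
        (\<forall>f\<in>funs n. \<phi> (Dec y a (map f (Qry y a))) = (\<Sum>i\<in>{1..n}. \<alpha> i * \<phi> (f i)) + \<beta>))"

definition success_prob ::
  "nat \<Rightarrow> ((nat \<Rightarrow> nat) \<Rightarrow> bool list) \<Rightarrow> (nat \<Rightarrow> bool list \<Rightarrow> nat list)
    \<Rightarrow> (nat \<Rightarrow> bool list \<Rightarrow> nat list \<Rightarrow> nat) \<Rightarrow> (nat \<Rightarrow> nat) \<Rightarrow> real" where
  "success_prob n Pre Qry Dec f =
     measure_pmf.prob (pmf_of_set {1..n})
       {x. let y = f x in Inv Pre Qry Dec y f \<in> preimage_of n f y}"

definition alpha_prob :: "nat \<Rightarrow> real \<Rightarrow> real \<Rightarrow> real" where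
  "alpha_prob n \<tau> \<delta> =
     measure_pmf.prob (pmf_of_set (funs n))
       {f. \<exists>X\<subseteq>{1..n}. real (card X) \<ge> \<tau> * real n \<and> real (card (f ` X)) \<le> \<delta> * real n}"

text \<open>
  \<open>inv_power \<delta> m\<close> is $\delta^{-m}$ as an extended real: in type \<open>real\<close> the value at \<open>\<delta> = 0\<close>, \<open>m > 0\<close>
  would be \<open>0\<close>, whereas here it is \<open>\<infinity>\<close> (and \<open>1\<close> for \<open>m = 0\<close>).
\<close>

definition inv_power :: "real \<Rightarrow> nat \<Rightarrow> ereal" where
  "inv_power \<delta> m = inverse (ereal \<delta>) ^ m"

lemma inv_power_pos: "\<delta> > 0 \<Longrightarrow> inv_power \<delta> m = ereal (\<delta> powi (- int m))"
  by (simp add: inv_power_def power_int_minus power_inverse)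

lemma inv_power_zero: "inv_power 0 m = (if m = 0 then 1 else \<infinity>)"
proof (cases m)
  case (Suc k)
  have "(\<infinity>::ereal) ^ Suc k = \<infinity>" by (induction k) auto
  with Suc show ?thesis by (simp add: inv_power_def)
qed (simp add: inv_power_def)

end

theory Submission imports Defs begin

text \<open>
  Fix an advice string and let \<open>S f\<close> be the set of points that the corresponding decoder inverts
  under \<open>f\<close>. The \<open>m\<close>-th moment of \<open>card (S f)\<close> counts \<open>m\<close>-tuples of inverted points. Revealing the
  points of such a tuple one at a time, together with the answers of the decoder, confines \<open>f\<close> to an
  affine subspace whose codimension grows by at most 2 per step. On a subspace of codimension \<open>l\<close> an
  affine functional is constant or equidistributed, and at most \<open>l\<close> coordinates are constant; hence
  a random further point is inverted with probability at most \<open>(2 * l + 2) / n\<close>. Markov's inequality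
  for the \<open>m\<close>-th moment and a union bound over the advice strings conclude. The
  resulting factors \<open>(4 * j - 2) / n\<close> are below \<open>2 * j / n + 4 * j / n\<close>.
\<close>

section \<open>Affine subspaces of function spaces over a finite field\<close>

text \<open>The three-point form is used because closure under lines through two points says nothing
  over the field with two elements. Dimension is never introduced: codimension at most
  \<open>l\<close> is expressed below as
  \<open>CARD('k) ^ CARD('i) \<le> card V * CARD('k) ^ l\<close>, which also excludes the empty
  set.\<close>

definition affine_set :: "('i \<Rightarrow> 'k::field) set \<Rightarrow> bool" where
  "affine_set V \<longleftrightarrow> (\<forall>f\<in>V. \<forall>g\<in>V. \<forall>h\<in>V. \<forall>c. (\<lambda>i. f i + c * (g i - h i)) \<in> V)"

definition affine_functional :: "(('i \<Rightarrow> 'k::field) \<Rightarrow> 'k) \<Rightarrow> bool" where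
  "affine_functional L \<longleftrightarrow> (\<forall>f g h c. L (\<lambda>i. f i + c * (g i - h i)) = L f + c * (L g - L h))"

definition fixed_coords :: "('i \<Rightarrow> 'k) set \<Rightarrow> 'i set" where
  "fixed_coords V = {i. \<forall>f\<in>V. \<forall>g\<in>V. f i = g i}"

lemma affine_setD:
  "affine_set V \<Longrightarrow> f \<in> V \<Longrightarrow> g \<in> V \<Longrightarrow> h \<in> V \<Longrightarrow> (\<lambda>i. f i + c * (g i - h i)) \<in> V"
  by (auto simp: affine_set_def)

lemma affine_functionalD:
  "affine_functional L \<Longrightarrow> L (\<lambda>i. f i + c * (g i - h i)) = L f + c * (L g - L h)"
  by (auto simp: affine_functional_def)

lemma affine_set_UNIV: "affine_set UNIV"
  by (simp add: affine_set_def)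

lemma affine_functional_coord: "affine_functional (\<lambda>f. f i)"
  by (simp add: affine_functional_def)

lemma affine_functional_sum:
  "affine_functional (\<lambda>f. (\<Sum>i\<in>A. a i * f (p i)) + b)"
  by (simp add: affine_functional_def algebra_simps sum.distrib sum_subtractf sum_distrib_left)

lemma affine_set_fiber:
  assumes "affine_set V" "affine_functional L"
  shows "affine_set {f \<in> V. L f = t}"
  using assms by (auto simp: affine_set_def affine_functional_def)

text \<open>Translating by a multiple of \<open>g - h\<close> moves any fiber of \<open>L\<close>
  injectively into any other, so the \<open>CARD('k)\<close> fibers partitioning \<open>V\<close>
  all have the same size.\<close>

lemma card_fiber_nonconst:
  fixes V :: "('i::finite \<Rightarrow> 'k::{field,finite}) set"
  assumes V: "affine_set V" and L: "affine_functional L"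
    and gh: "g \<in> V" "h \<in> V" "L g \<noteq> L h"
  shows "CARD('k) * card {f \<in> V. L f = t} = card V"
proof -
  define F where "F t = {f \<in> V. L f = t}" for t
  have le: "card (F t) \<le> card (F u)" for t u
  proof (rule card_inj_on_le)
    \<comment> \<open>The scalar is chosen so that the translation changes the value of
      \<open>L\<close> by exactly \<open>u - t\<close>.\<close>
    let ?T = "\<lambda>f i. f i + (u - t) / (L g - L h) * (g i - h i)"
    show "inj_on ?T (F t)"
      by (auto simp: inj_on_def fun_eq_iff)
    show "?T ` F t \<subseteq> F u"
    proof
      fix f' assume "f' \<in> ?T ` F t"
      then obtain f where f: "f \<in> V" "L f = t" "f' = ?T f" by (auto simp: F_def)
      have "f' \<in> V" unfolding f(3) by (rule affine_setD[OF V f(1) gh(1,2)])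
      moreover have "L f' = u"
        unfolding f(3) affine_functionalD[OF L] using gh(3) f(2) by simp
      ultimately show "f' \<in> F u" by (simp add: F_def)
    qed
  qed simp
  have "V = (\<Union>u. F u)" by (auto simp: F_def)
  then have "card V = card (\<Union>u\<in>UNIV. F u)" by simp
  also have "\<dots> = (\<Sum>u\<in>UNIV. card (F u))"
    by (rule card_UN_disjoint) (auto simp: F_def)
  also have "\<dots> = (\<Sum>u\<in>(UNIV::'k set). card (F t))"
    using le by (intro sum.cong) (auto intro: antisym)
  finally show ?thesis by (simp add: F_def)
qed

text \<open>A consistent affine equation raises the codimension by at most one. Consistency matters:
  a constant \<open>L\<close> has empty fibers.\<close>

lemma card_le_fiber:
  fixes V :: "('i::finite \<Rightarrow> 'k::{field,finite}) set"
  assumes V: "affine_set V" and L: "affine_functional L" and ne: "{f \<in> V. L f = t} \<noteq> {}"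
  shows "card V \<le> CARD('k) * card {f \<in> V. L f = t}"
proof (cases "\<exists>g\<in>V. \<exists>h\<in>V. L g \<noteq> L h")
  case True
  then obtain g h where "g \<in> V" "h \<in> V" "L g \<noteq> L h" by blast
  from card_fiber_nonconst[OF V L this] show ?thesis by simp
next
  case False
  then have "{f \<in> V. L f = t} = V" using ne by blast
  then show ?thesis by simp
qed

lemma card_coord_fiber:
  fixes V :: "('i::finite \<Rightarrow> 'k::{field,finite}) set"
  assumes V: "affine_set V" and "i \<notin> fixed_coords V"
  shows "CARD('k) * card {f \<in> V. f i = t} = card V"
  using assms card_fiber_nonconst[OF V affine_functional_coord[of i]]
  by (auto simp: fixed_coords_def)

lemma card_field_ge_2: "2 \<le> CARD('k::{field,finite})"
proof -
  have "card {0, 1::'k} \<le> CARD('k)" by (rule card_mono) auto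
  then show ?thesis by simp
qed

text \<open>An element of \<open>V\<close> is determined by its coordinates outside
  \<open>fixed_coords V\<close>, so each fixed coordinate costs \<open>V\<close> a factor
  \<open>CARD('k)\<close> in size.\<close>

lemma card_fixed_coords_le:
  fixes V :: "('i::finite \<Rightarrow> 'k::{field,finite}) set"
  assumes "CARD('k) ^ CARD('i) \<le> card V * CARD('k) ^ l"
  shows "card (fixed_coords V) \<le> l"
proof -
  let ?C = "fixed_coords V"
  have "card V \<le> card ((- ?C) \<rightarrow>\<^sub>E (UNIV :: 'k set))"
  proof (rule card_inj_on_le)
    show "inj_on (\<lambda>f. restrict f (- ?C)) V"
    proof (rule inj_onI)
      fix f g assume fg: "f \<in> V" "g \<in> V" "restrict f (- ?C) = restrict g (- ?C)"
      show "f = g"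
      proof
        fix i
        show "f i = g i"
        proof (cases "i \<in> ?C")
          case True then show ?thesis using fg by (auto simp: fixed_coords_def)
        next
          case False then show ?thesis using fun_cong[OF fg(3), of i] by simp
        qed
      qed
    qed
  qed (auto intro: finite_PiE)
  also have "\<dots> = CARD('k) ^ card (- ?C)" by (simp add: card_PiE)
  finally have "CARD('k) ^ CARD('i) \<le> CARD('k) ^ card (- ?C) * CARD('k) ^ l"
    using assms by (meson le_trans mult_le_mono1)
  then have "CARD('k) ^ CARD('i) \<le> CARD('k) ^ (card (- ?C) + l)"
    by (simp add: power_add)
  then have "CARD('i) \<le> card (- ?C) + l"
    using card_field_ge_2[where 'k='k] by (subst (asm) power_increasing_iff) auto
  moreover have "card (- ?C) = CARD('i) - card ?C"
    by (simp add: Compl_eq_Diff_UNIV card_Diff_subset)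
  moreover have "card ?C \<le> CARD('i)" by (rule card_mono) auto
  ultimately show ?thesis by linarith
qed

text \<open>Nonempty fibers of \<open>L\<close> are parallel: they have the same differences, and a
  coordinate is fixed exactly when it vanishes on all differences.\<close>

lemma fixed_coords_fiber_eq:
  assumes V: "affine_set V" and L: "affine_functional L"
    and h: "h \<in> V" "L h = t" and h': "h' \<in> V" "L h' = u"
  shows "fixed_coords {f \<in> V. L f = t} = fixed_coords {f \<in> V. L f = u}"
proof -
  have sub: "fixed_coords {f \<in> V. L f = L h} \<subseteq> fixed_coords {f \<in> V. L f = w}"
    if "h \<in> V" for h w
  proof
    fix i assume i: "i \<in> fixed_coords {f \<in> V. L f = L h}"
    show "i \<in> fixed_coords {f \<in> V. L f = w}"
      unfolding fixed_coords_def
    proof (intro CollectI ballI)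
      fix f g assume fg: "f \<in> {f \<in> V. L f = w}" "g \<in> {f \<in> V. L f = w}"
      \<comment> \<open>The difference \<open>f - g\<close> of two points of one fiber is
        transported to the base point \<open>h\<close> of the other.\<close>
      let ?k = "\<lambda>i. h i + 1 * (f i - g i)"
      have "?k \<in> V" using affine_setD[OF V, of h f g 1] that fg by blast
      moreover have "L ?k = L h" unfolding affine_functionalD[OF L] using fg by simp
      ultimately have k: "?k \<in> {f \<in> V. L f = L h}" and h: "h \<in> {f \<in> V. L f = L h}"
        using that by blast+
      have "\<forall>f\<in>{f \<in> V. L f = L h}. \<forall>g\<in>{f \<in> V. L f = L h}. f i = g i"
        using i unfolding fixed_coords_def by (rule CollectD)
      from this[rule_format, OF k h] have "?k i = h i" .
      then show "f i = g i" by simp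
    qed
  qed
  show ?thesis using sub[of h u] sub[of h' t] h h' by blast
qed

section \<open>Counting the functions in a subspace that are inverted at a point\<close>

text \<open>If \<open>L\<close> is constant on \<open>V\<close>, a single coordinate is compared
  with \<open>y\<close>: either it is equidistributed, or it is fixed and only its one value can be
  hit, which the conditional term pays for. If \<open>L\<close> is not constant, its fibers are
  equally large and are treated one by one; at most \<open>l + 1\<close> of them can be bad.\<close>

lemma card_inverted_functions:
  fixes V :: "('k::{field,finite} \<Rightarrow> 'k) set"
  assumes V: "affine_set V" and L: "affine_functional L"
    and big: "CARD('k) ^ CARD('k) \<le> card V * CARD('k) ^ l"
    and f0: "f0 \<in> V"
  shows "CARD('k) * card {f \<in> V. f (L f) = y}
    \<le> (l + 2) * card V + (if y \<in> f0 ` fixed_coords V then CARD('k) * card V else 0)"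
proof (cases "\<exists>g\<in>V. \<exists>h\<in>V. L g \<noteq> L h")
  case False
  then have Lc: "L f = L f0" if "f \<in> V" for f using f0 that by blast
  then have eq: "{f \<in> V. f (L f) = y} = {f \<in> V. f (L f0) = y}" by auto
  show ?thesis
  proof (cases "L f0 \<in> fixed_coords V")
    case fixed: True
    show ?thesis
    proof (cases "y \<in> f0 ` fixed_coords V")
      case True
      have "card {f \<in> V. f (L f) = y} \<le> card V" by (rule card_mono) auto
      then show ?thesis using True by (simp add: trans_le_add2)
    next
      case False
      have "f (L f0) \<noteq> y" if "f \<in> V" for f
        using fixed False f0 that by (force simp: fixed_coords_def)
      then have "{f \<in> V. f (L f) = y} = {}" unfolding eq by blast
      then show ?thesis by (simp only: card.empty)
    qed
  next
    case False
    show ?thesis unfolding eq card_coord_fiber[OF V False] by simp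
  qed
next
  case True
  define F where "F x = {f \<in> V. L f = x}" for x
  define G where "G x = {f \<in> F x. f x = y}" for x
  define C where "C = fixed_coords (F 0)"
  have cF: "CARD('k) * card (F x) = card V" for x
    using True card_fiber_nonconst[OF V L] unfolding F_def by blast
  have "card V > 0" using f0 by (auto simp: card_gt_0_iff)
  then have neF: "F x \<noteq> {}" for x using cF[of x] by auto
  have aF: "affine_set (F x)" for x unfolding F_def by (rule affine_set_fiber[OF V L])
  have C: "fixed_coords (F x) = C" for x
    using neF[of x] neF[of 0] fixed_coords_fiber_eq[OF V L]
    unfolding C_def F_def by blast
  \<comment> \<open>Passing to a fiber costs one codimension, so \<open>l + 1\<close> bounds the
    number of points \<open>x\<close> whose coordinate is fixed on the fibers.\<close>
  have "CARD('k) ^ CARD('k) \<le> card (F 0) * CARD('k) ^ (l + 1)"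
    using big cF[of 0] by (metis add.commute mult.assoc mult.commute plus_1_eq_Suc power_Suc)
  then have cC: "card C \<le> l + 1" unfolding C_def by (rule card_fixed_coords_le)
  have "{f \<in> V. f (L f) = y} = (\<Union>x. G x)" by (auto simp: G_def F_def)
  then have "card {f \<in> V. f (L f) = y} = card (\<Union>x\<in>UNIV. G x)" by simp
  also have "\<dots> = (\<Sum>x\<in>UNIV. card (G x))"
    by (rule card_UN_disjoint) (auto simp: F_def G_def)
  finally have "CARD('k) * card {f \<in> V. f (L f) = y} = (\<Sum>x\<in>UNIV. CARD('k) * card (G x))"
    by (simp add: sum_distrib_left)
  \<comment> \<open>On the fiber over \<open>x \<in> C\<close> all functions may be inverted; over
    any other \<open>x\<close> the value at \<open>x\<close> is equidistributed.\<close>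
  also have "\<dots> \<le> (\<Sum>x\<in>UNIV. (if x \<in> C then card V else 0) + card (F x))"
  proof (rule sum_mono)
    fix x
    show "CARD('k) * card (G x) \<le> (if x \<in> C then card V else 0) + card (F x)"
    proof (cases "x \<in> C")
      case True
      have "card (G x) \<le> card (F x)" by (rule card_mono) (auto simp: G_def)
      then have "CARD('k) * card (G x) \<le> card V" using cF[of x] by (metis mult_le_mono2)
      then show ?thesis using True by simp
    next
      case False
      then have "CARD('k) * card (G x) = card (F x)"
        unfolding G_def using card_coord_fiber[OF aF] C by blast
      then show ?thesis by simp
    qed
  qed
  also have "\<dots> = card C * card V + (\<Sum>x\<in>UNIV. card (F x))"
    by (simp add: sum.distrib sum.If_cases)
  also have "(\<Sum>x\<in>UNIV. card (F x)) = card V"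
  proof -
    have "CARD('k) * card (F x) = CARD('k) * card (F 0)" for x by (simp only: cF)
    then have "card (F x) = card (F 0)" for x by simp
    then have "(\<Sum>x\<in>UNIV. card (F x)) = (\<Sum>x\<in>(UNIV::'k set). card (F 0))"
      by (intro sum.cong refl)
    then show ?thesis by (simp add: cF)
  qed
  also have "card C * card V + card V \<le> (l + 2) * card V"
    using mult_le_mono1[OF cC, of "card V"] by (simp add: algebra_simps)
  finally show ?thesis by (rule trans_le_add1)
qed

text \<open>At most \<open>l\<close> points \<open>y\<close> are values of fixed coordinates. Their
  extra terms add \<open>l\<close> to the \<open>l + 2\<close> obtained from summing the generic
  bound over all \<open>y\<close>.\<close>

lemma sum_card_inverted_functions:
  fixes V :: "('k::{field,finite} \<Rightarrow> 'k) set"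
  assumes V: "affine_set V" and D: "\<And>y. affine_functional (D y)"
    and big: "CARD('k) ^ CARD('k) \<le> card V * CARD('k) ^ l"
  shows "(\<Sum>y\<in>UNIV. card {f \<in> V. f (D y f) = y}) \<le> (2 * l + 2) * card V"
proof -
  let ?n = "CARD('k)"
  have "V \<noteq> {}" using big by auto
  then obtain f0 where f0: "f0 \<in> V" by blast
  let ?B = "f0 ` fixed_coords V"
  have "card ?B \<le> card (fixed_coords V)" by (rule card_image_le) simp
  then have B: "card ?B \<le> l" using card_fixed_coords_le[OF big] by linarith
  have "?n * (\<Sum>y\<in>UNIV. card {f \<in> V. f (D y f) = y})
      \<le> (\<Sum>y\<in>UNIV. (l + 2) * card V + (if y \<in> ?B then ?n * card V else 0))"
    unfolding sum_distrib_left by (intro sum_mono card_inverted_functions V D big f0)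
  also have "\<dots> = ?n * ((l + 2) * card V) + card ?B * (?n * card V)"
    by (simp only: sum.distrib sum_constant sum.If_cases finite) simp
  also have "\<dots> \<le> ?n * ((l + 2) * card V) + l * (?n * card V)"
    using B by simp
  also have "\<dots> = ?n * ((2 * l + 2) * card V)" by (simp add: algebra_simps)
  finally show ?thesis by simp
qed

section \<open>Moments of the number of inverted points\<close>

text \<open>One factor of the power is expanded as a sum over inverted points \<open>y\<close>.
  Fixing \<open>y\<close> and the answer \<open>x\<close> of the decoder imposes two affine
  equations, so the induction runs over all \<open>V\<close> and passes from \<open>l\<close> to
  \<open>l + 2\<close>.\<close>

lemma moment_inverted_points:
  fixes V :: "('k::{field,finite} \<Rightarrow> 'k) set"
  assumes "affine_set V" and D: "\<And>y. affine_functional (D y)"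
    and "CARD('k) ^ CARD('k) \<le> card V * CARD('k) ^ l"
  shows "(\<Sum>f\<in>V. card {y. f (D y f) = y} ^ m) \<le> (\<Prod>j<m. 2 * (l + 2 * j) + 2) * card V"
  using assms(1,3)
proof (induction m arbitrary: V l)
  case 0
  then show ?case by simp
next
  case (Suc m)
  let ?n = "CARD('k)"
  define S where "S f = {y. f (D y f) = y}" for f
  define W where "W y x = {f \<in> {f \<in> V. D y f = x}. f x = y}" for y x
  define P where "P = (\<Prod>j<m. 2 * ((l + 2) + 2 * j) + 2)"
  have W: "(\<Sum>f\<in>W y x. card (S f) ^ m) \<le> P * card (W y x)" for y x
  proof (cases "W y x = {}")
    case False
    have aff: "affine_set {f \<in> V. D y f = x}"
      using affine_set_fiber[OF Suc.prems(1) D] .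
    have "card V \<le> ?n * card {f \<in> V. D y f = x}"
      by (rule card_le_fiber[OF Suc.prems(1) D]) (use False in \<open>auto simp: W_def\<close>)
    also have "\<dots> \<le> ?n * (?n * card (W y x))"
      unfolding W_def
      by (intro mult_le_mono2 card_le_fiber[OF aff affine_functional_coord])
         (use False in \<open>auto simp: W_def\<close>)
    finally have "card V * ?n ^ l \<le> ?n * (?n * card (W y x)) * ?n ^ l"
      by (rule mult_le_mono1)
    also have "\<dots> = card (W y x) * ?n ^ (l + 2)"
      by (simp add: power_add power2_eq_square mult_ac)
    finally have "?n ^ ?n \<le> card (W y x) * ?n ^ (l + 2)"
      by (rule le_trans[OF Suc.prems(2)])
    moreover have "affine_set (W y x)"
      unfolding W_def by (rule affine_set_fiber[OF aff affine_functional_coord])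
    ultimately show ?thesis unfolding S_def P_def using Suc.IH by blast
  qed simp
  have "(\<Sum>f\<in>V. card (S f) ^ Suc m) = (\<Sum>f\<in>V. \<Sum>y\<in>UNIV. if y \<in> S f then card (S f) ^ m else 0)"
    by (simp add: sum.If_cases)
  also have "\<dots> = (\<Sum>y\<in>UNIV. \<Sum>f\<in>V. if y \<in> S f then card (S f) ^ m else 0)"
    by (rule sum.swap)
  also have "\<dots> = (\<Sum>y\<in>UNIV. \<Sum>f\<in>{f \<in> V. y \<in> S f}. card (S f) ^ m)"
    by (simp add: sum.inter_filter)
  also have "\<dots> = (\<Sum>y\<in>UNIV. \<Sum>x\<in>UNIV. \<Sum>f\<in>W y x. card (S f) ^ m)"
  proof (rule sum.cong[OF refl])
    fix y
    have "(\<Sum>x\<in>UNIV. \<Sum>f\<in>{f \<in> {f \<in> V. y \<in> S f}. D y f = x}. card (S f) ^ m)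
        = (\<Sum>f\<in>{f \<in> V. y \<in> S f}. card (S f) ^ m)"
      by (rule sum.group) auto
    moreover have "{f \<in> {f \<in> V. y \<in> S f}. D y f = x} = W y x" for x
      by (auto simp: W_def S_def)
    ultimately show "(\<Sum>f\<in>{f \<in> V. y \<in> S f}. card (S f) ^ m)
        = (\<Sum>x\<in>UNIV. \<Sum>f\<in>W y x. card (S f) ^ m)" by simp
  qed
  also have "\<dots> \<le> (\<Sum>y\<in>UNIV. \<Sum>x\<in>UNIV. P * card (W y x))"
    by (intro sum_mono W)
  also have "\<dots> = P * (\<Sum>y\<in>UNIV. \<Sum>x\<in>UNIV. card (W y x))"
    by (simp add: sum_distrib_left)
  \<comment> \<open>For fixed \<open>y\<close> the pieces \<open>W y x\<close> are disjoint, since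
    \<open>x\<close> is the answer of the decoder; this reduces to the first-moment bound on
    \<open>V\<close>.\<close>
  also have "(\<Sum>y\<in>UNIV. \<Sum>x\<in>UNIV. card (W y x)) = (\<Sum>y\<in>UNIV. card {f \<in> V. f (D y f) = y})"
  proof (rule sum.cong[OF refl])
    fix y
    have "{f \<in> V. f (D y f) = y} = (\<Union>x. W y x)" by (auto simp: W_def)
    then have "card {f \<in> V. f (D y f) = y} = card (\<Union>x\<in>UNIV. W y x)" by simp
    also have "\<dots> = (\<Sum>x\<in>UNIV. card (W y x))"
      by (rule card_UN_disjoint) (auto simp: W_def)
    finally show "(\<Sum>x\<in>UNIV. card (W y x)) = card {f \<in> V. f (D y f) = y}" by simp
  qed
  also have "P * \<dots> \<le> P * ((2 * l + 2) * card V)"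
    by (intro mult_le_mono2 sum_card_inverted_functions[OF Suc.prems(1) D Suc.prems(2)])
  also have "\<dots> = (\<Prod>j<Suc m. 2 * (l + 2 * j) + 2) * card V"
  proof -
    \<comment> \<open>The factors from codimension \<open>l + 2\<close> are those with index shifted
      by one; the new factor \<open>2 * l + 2\<close> takes index 0.\<close>
    have "P = (\<Prod>j<m. 2 * (l + 2 * Suc j) + 2)"
      unfolding P_def by (rule prod.cong) simp_all
    then show ?thesis by (simp only: prod.lessThan_Suc_shift mult_0_right add_0_right) (simp only: mult_ac)
  qed
  finally show ?case unfolding S_def .
qed

section \<open>Transfer from functions on \<open>{1..n}\<close> to vectors over the field\<close>

lemma card_funs: "card (funs n) = n ^ n"
  by (simp add: funs_def card_PiE)

lemma finite_funs: "finite (funs n)"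
  by (simp add: funs_def finite_PiE)

lemma card_advice: "card (advice s) = 2 ^ s"
  using card_lists_length_eq[of "UNIV :: bool set" s] by (simp add: advice_def)

lemma finite_advice: "finite (advice s)"
  using finite_lists_length_eq[of "UNIV :: bool set" s] by (simp add: advice_def)

text \<open>Conjugating by \<open>\<phi>\<close> turns both arguments and values into field
  elements, so that an answer of the decoder can itself serve as a coordinate index. The whole space
  then gives the moment bound with \<open>l = 0\<close>.\<close>

lemma moment_affine_decoder:
  fixes \<phi> :: "nat \<Rightarrow> 'k::{field,finite}"
  assumes n: "n = CARD('k)" and phi: "bij_betw \<phi> {1..n} UNIV"
    and inverter: "nonadaptive_inverter n s q Pre Qry Dec"
    and affine: "affine_decoder n s q \<phi> Qry Dec" and a: "a \<in> advice s"
  shows "(\<Sum>f\<in>funs n. card {y \<in> {1..n}. f (Dec y a (map f (Qry y a))) = y} ^ m)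
    \<le> (\<Prod>j<m. 4 * j + 2) * n ^ n"
proof -
  define \<psi> where "\<psi> = the_inv_into {1..n} \<phi>"
  have psi_phi: "\<psi> (\<phi> i) = i" if "i \<in> {1..n}" for i
    using phi that unfolding \<psi>_def by (simp add: bij_betw_def the_inv_into_f_f)
  have phi_inj: "\<phi> i = \<phi> j \<longleftrightarrow> i = j" if "i \<in> {1..n}" "j \<in> {1..n}" for i j
    using psi_phi that by metis
  have "\<forall>y\<in>{1..n}. \<exists>\<alpha> \<beta>. \<forall>f\<in>funs n.
      \<phi> (Dec y a (map f (Qry y a))) = (\<Sum>i\<in>{1..n}. \<alpha> i * \<phi> (f i)) + \<beta>"
    using affine a unfolding affine_decoder_def by blast
  then obtain \<alpha> \<beta> where dec: "\<And>y f. y \<in> {1..n} \<Longrightarrow> f \<in> funs n \<Longrightarrow>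
      \<phi> (Dec y a (map f (Qry y a))) = (\<Sum>i\<in>{1..n}. \<alpha> y i * \<phi> (f i)) + \<beta> y"
    by metis
  define D where "D y v = (\<Sum>i\<in>{1..n}. \<alpha> (\<psi> y) i * v (\<phi> i)) + \<beta> (\<psi> y)" for y v
  define vec where "vec f = (\<lambda>k. \<phi> (f (\<psi> k)))" for f
  let ?S = "\<lambda>f. {y \<in> {1..n}. f (Dec y a (map f (Qry y a))) = y}"
  have range: "f i \<in> {1..n}" if "f \<in> funs n" "i \<in> {1..n}" for f i
    using that by (auto simp: funs_def)
  have inj: "inj_on vec (funs n)"
  proof (rule inj_onI)
    fix f g assume fg: "f \<in> funs n" "g \<in> funs n" "vec f = vec g"
    show "f = g"
    proof (rule PiE_ext)
      fix i assume i: "i \<in> {1..n}"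
      have "\<phi> (f i) = \<phi> (g i)" using fun_cong[OF fg(3), of "\<phi> i"] psi_phi[OF i]
        by (simp add: vec_def)
      then show "f i = g i" using phi_inj range fg(1,2) i by blast
    qed (use fg in \<open>auto simp: funs_def\<close>)
  qed
  have card_eq: "card (?S f) \<le> card {y. vec f (D y (vec f)) = y}" if f: "f \<in> funs n" for f
  proof (rule card_inj_on_le)
    show "inj_on \<phi> (?S f)" using phi_inj by (auto simp: inj_on_def)
    show "\<phi> ` ?S f \<subseteq> {y. vec f (D y (vec f)) = y}"
    proof (intro subsetI)
      fix z assume "z \<in> \<phi> ` ?S f"
      then obtain y where y: "y \<in> {1..n}" "f (Dec y a (map f (Qry y a))) = y" "z = \<phi> y"
        by blast
      have "set (Qry y a) \<subseteq> {1..n}" "length (Qry y a) = q"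
        using inverter y(1) a by (auto simp: nonadaptive_inverter_def tuples_def)
      then have "map f (Qry y a) \<in> tuples n q"
        using range[OF f] by (auto simp: tuples_def)
      \<comment> \<open>The range condition on the decoder makes \<open>\<psi>\<close> recover its
        answer from the field element.\<close>
      then have d: "Dec y a (map f (Qry y a)) \<in> {1..n}"
        using inverter y(1) a unfolding nonadaptive_inverter_def by blast
      have "D z (vec f) = \<phi> (Dec y a (map f (Qry y a)))"
        unfolding D_def y(3) psi_phi[OF y(1)] dec[OF y(1) f]
        by (simp add: vec_def psi_phi)
      then show "z \<in> {y. vec f (D y (vec f)) = y}"
        using psi_phi[OF d] y by (simp add: vec_def)
    qed
  qed simp
  have "(\<Sum>f\<in>funs n. card (?S f) ^ m)
      \<le> (\<Sum>f\<in>funs n. card {y. vec f (D y (vec f)) = y} ^ m)"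
    by (intro sum_mono power_mono card_eq) auto
  also have "\<dots> = (\<Sum>v\<in>vec ` funs n. card {y. v (D y v) = y} ^ m)"
    by (simp add: sum.reindex[OF inj])
  also have "\<dots> \<le> (\<Sum>v\<in>UNIV. card {y. v (D y v) = y} ^ m)"
    by (rule sum_mono2) auto
  also have "\<dots> \<le> (\<Prod>j<m. 2 * (0 + 2 * j) + 2) * card (UNIV :: ('k \<Rightarrow> 'k) set)"
  proof (rule moment_inverted_points[OF affine_set_UNIV])
    show "affine_functional (D y)" for y
      unfolding D_def by (rule affine_functional_sum)
  qed (simp add: card_fun)
  finally show ?thesis by (simp add: card_fun n mult.assoc[symmetric])
qed

section \<open>Markov's inequality and the union bound over advice strings\<close>

lemma prob_funs: "n > 0 \<Longrightarrow> measure_pmf.prob (pmf_of_set (funs n)) A = card (funs n \<inter> A) / n ^ n"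
  using card_funs[of n] finite_funs[of n]
  by (subst measure_pmf_of_set) (auto simp: card_gt_0_iff)

lemma prob_many_inverted:
  fixes \<phi> :: "nat \<Rightarrow> 'k::{field,finite}" and \<delta> :: real
  assumes n: "n = CARD('k)" and phi: "bij_betw \<phi> {1..n} UNIV"
    and inverter: "nonadaptive_inverter n s q Pre Qry Dec"
    and affine: "affine_decoder n s q \<phi> Qry Dec" and a: "a \<in> advice s" and \<delta>: "\<delta> > 0"
  shows "measure_pmf.prob (pmf_of_set (funs n))
      {f. \<delta> * n \<le> card {y \<in> {1..n}. f (Dec y a (map f (Qry y a))) = y}}
    \<le> inverse \<delta> ^ m * (\<Prod>j=1..m. (4 * real j - 2) / n)"
proof -
  define S where "S f = {y \<in> {1..n}. f (Dec y a (map f (Qry y a))) = y}" for f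
  let ?E = "funs n \<inter> {f. \<delta> * n \<le> card (S f)}"
  have npos: "n > 0" using n by simp
  have "card ?E * (\<delta> * n) ^ m = (\<Sum>f\<in>?E. (\<delta> * n) ^ m)" by simp
  also have "\<dots> \<le> (\<Sum>f\<in>?E. real (card (S f)) ^ m)"
    using \<delta> by (intro sum_mono power_mono) auto
  also have "\<dots> \<le> (\<Sum>f\<in>funs n. real (card (S f)) ^ m)"
    by (rule sum_mono2) (auto simp: finite_funs)
  also have "\<dots> = real (\<Sum>f\<in>funs n. card (S f) ^ m)" by simp
  also have "\<dots> \<le> real ((\<Prod>j<m. 4 * j + 2) * n ^ n)"
    unfolding S_def using moment_affine_decoder[OF n phi inverter affine a]
    by (intro of_nat_mono)
  also have "\<dots> = (\<Prod>j<m. 4 * real j + 2) * n ^ n"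
    by (simp add: add.commute)
  \<comment> \<open>Counting from 1 instead of 0 replaces \<open>4 * j + 2\<close> by
    \<open>4 * (j - 1) + 2\<close>.\<close>
  also have "(\<Prod>j<m. 4 * real j + 2) = (\<Prod>j=1..m. 4 * real j - 2)"
    by (rule prod.reindex_bij_witness[of _ "\<lambda>j. j - 1" Suc]) auto
  finally have "card ?E * (\<delta> * n) ^ m \<le> (\<Prod>j=1..m. 4 * real j - 2) * n ^ n" .
  then have "card ?E / n ^ n \<le> (\<Prod>j=1..m. 4 * real j - 2) / (\<delta> * n) ^ m"
    using \<delta> npos by (simp add: field_simps)
  also have "\<dots> = inverse \<delta> ^ m * (\<Prod>j=1..m. (4 * real j - 2) / n)"
    by (simp add: prod_dividef power_mult_distrib field_simps)
  finally show ?thesis using prob_funs[OF npos] by (simp add: S_def)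
qed

lemma success_prob_eq:
  assumes "n > 0"
  shows "success_prob n Pre Qry Dec f
    = card {x \<in> {1..n}. Inv Pre Qry Dec (f x) f \<in> preimage_of n f (f x)} / n"
proof -
  have "{1..n} \<inter> {x. let y = f x in Inv Pre Qry Dec y f \<in> preimage_of n f y}
      = {x \<in> {1..n}. Inv Pre Qry Dec (f x) f \<in> preimage_of n f (f x)}"
    by (auto simp: Let_def)
  then show ?thesis
    using assms unfolding success_prob_def by (subst measure_pmf_of_set) auto
qed

text \<open>The set of inputs on which the inverter succeeds is large, so \<open>spread\<close>
  forces its image to be large, and every point of that image is inverted.\<close>

lemma success_imp_many_inverted:
  fixes \<tau> \<delta> :: real
  assumes n: "n > 0" and f: "f \<in> funs n" and succ: "\<tau> \<le> success_prob n Pre Qry Dec f"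
    and spread: "\<not> (\<exists>X\<subseteq>{1..n}. \<tau> * n \<le> card X \<and> card (f ` X) \<le> \<delta> * n)"
  shows "\<delta> * n \<le> card {y \<in> {1..n}. f (Dec y (Pre f) (map f (Qry y (Pre f)))) = y}"
proof -
  let ?X = "{x \<in> {1..n}. Inv Pre Qry Dec (f x) f \<in> preimage_of n f (f x)}"
  let ?S = "{y \<in> {1..n}. f (Dec y (Pre f) (map f (Qry y (Pre f)))) = y}"
  have "\<tau> * n \<le> card ?X"
    using succ n by (simp add: success_prob_eq field_simps)
  then have "\<delta> * n < card (f ` ?X)"
    using spread[simplified, rule_format, of ?X] by force
  moreover have "f ` ?X \<subseteq> ?S"
    using f by (auto simp: Inv_def Let_def preimage_of_def funs_def)
  then have "card (f ` ?X) \<le> card ?S" by (rule card_mono[rotated]) simp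
  ultimately show ?thesis by linarith
qed

theorem theorem5p3:
  fixes n s q m :: nat
    and \<phi> :: "nat \<Rightarrow> 'k::{field,finite}"
    and Pre :: "(nat \<Rightarrow> nat) \<Rightarrow> bool list"
    and Qry :: "nat \<Rightarrow> bool list \<Rightarrow> nat list"
    and Dec :: "nat \<Rightarrow> bool list \<Rightarrow> nat list \<Rightarrow> nat"
    and \<tau> \<delta> :: real
  assumes "n = CARD('k)"
    and "bij_betw \<phi> {1..n} (UNIV :: 'k set)"
    and "nonadaptive_inverter n s q Pre Qry Dec"
    and "affine_decoder n s q \<phi> Qry Dec"
    and "\<tau> \<in> {0..1}"
    and "\<delta> \<in> {0..1}"
    and "real m \<le> real n / 16"
  shows "ereal (measure_pmf.prob (pmf_of_set (funs n)) {f. success_prob n Pre Qry Dec f \<ge> \<tau>})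
    \<le> ereal (alpha_prob n \<tau> \<delta>)
      + 2 ^ s * inv_power \<delta> m
        * ereal (\<Prod>j=1..m. 2 * real j / real n + max (root 4 (1 / real n)) (4 * real j / real n))"
proof -
  let ?p = "measure_pmf.prob (pmf_of_set (funs n))"
  let ?E = "{f. success_prob n Pre Qry Dec f \<ge> \<tau>}"
  let ?A = "{f. \<exists>X\<subseteq>{1..n}. real (card X) \<ge> \<tau> * real n \<and> real (card (f ` X)) \<le> \<delta> * real n}"
  define Q where
    "Q = (\<Prod>j=1..m. 2 * real j / real n + max (root 4 (1 / real n)) (4 * real j / real n))"
  define R where "R = (\<Prod>j=1..m. (4 * real j - 2) / n)"
  have n: "n > 0" using assms(1) by simp
  have two_power: "(2::ereal) ^ s = ereal (2 ^ s)"
    by (induction s) auto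
  \<comment> \<open>The fourth root is positive. Strict positivity is what keeps the right-hand side
    infinite when \<open>\<delta> = 0\<close> and \<open>m > 0\<close>.\<close>
  have Qpos: "Q > 0" unfolding Q_def
    by (rule prod_pos) (use n in \<open>auto intro!: add_pos_nonneg simp: le_max_iff_disj\<close>)
  have RQ: "R \<le> Q" unfolding R_def Q_def
  proof (rule prod_mono, intro conjI)
    fix j assume j: "j \<in> {1..m}"
    show "0 \<le> (4 * real j - 2) / n" using j by simp
    have "(4 * real j - 2) / n \<le> 2 * real j / n + 4 * real j / n"
      using n by (simp add: field_simps)
    also have "\<dots> \<le> 2 * real j / n + max (root 4 (1 / n)) (4 * real j / n)"
      by simp
    finally show "(4 * real j - 2) / n \<le> 2 * real j / n + max (root 4 (1 / n)) (4 * real j / n)" .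
  qed
  show ?thesis
  \<comment> \<open>Markov's inequality requires a positive threshold. At
    \<open>\<delta> = 0\<close> the bound is trivial: infinite for \<open>m > 0\<close>, and at
    least \<open>2 ^ s\<close> for \<open>m = 0\<close>.\<close>
  proof (cases "\<delta> = 0")
    case True
    show ?thesis
    proof (cases "m = 0")
      case m: True
      have "?p ?E \<le> 1" by simp
      also have "\<dots> \<le> alpha_prob n \<tau> \<delta> + 2 ^ s"
        by (simp add: alpha_prob_def add_increasing)
      finally have "ereal (?p ?E) \<le> ereal (alpha_prob n \<tau> \<delta> + 2 ^ s)" by simp
      then show ?thesis using True m by (simp add: inv_power_zero two_power)
    next
      case False
      have inf: "2 ^ s * inv_power \<delta> m * ereal Q = \<infinity>"
        using True False Qpos by (simp add: inv_power_zero two_power)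
      show ?thesis unfolding Q_def[symmetric] inf by simp
    qed
  next
    case False
    then have \<delta>: "\<delta> > 0" using assms(6) by simp
    \<comment> \<open>Here \<open>a\<close> is independent of \<open>f\<close>, so each
      \<open>B a\<close> concerns one fixed affine decoder; the actual advice \<open>Pre f\<close>
      is one of the \<open>2 ^ s\<close> choices.\<close>
    define B where
      "B a = {f. \<delta> * n \<le> card {y \<in> {1..n}. f (Dec y a (map f (Qry y a))) = y}}" for a
    have cover: "funs n \<inter> ?E \<subseteq> ?A \<union> (\<Union>a\<in>advice s. B a)"
    proof
      fix f assume f: "f \<in> funs n \<inter> ?E"
      then have "Pre f \<in> advice s" using assms(3) by (simp add: nonadaptive_inverter_def)
      moreover have "f \<in> B (Pre f)" if "f \<notin> ?A"
        using that f success_imp_many_inverted[OF n, of f \<tau> Pre Qry Dec \<delta>] by (auto simp: B_def)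
      ultimately show "f \<in> ?A \<union> (\<Union>a\<in>advice s. B a)" by blast
    qed
    have "?p ?E = ?p (funs n \<inter> ?E)"
      using prob_funs[OF n] by simp
    also have "\<dots> \<le> ?p (?A \<union> (\<Union>a\<in>advice s. B a))"
      by (rule measure_pmf.finite_measure_mono[OF cover]) simp
    also have "\<dots> \<le> ?p ?A + ?p (\<Union>a\<in>advice s. B a)"
      by (rule measure_Un_le) simp_all
    also have "?p (\<Union>a\<in>advice s. B a) \<le> (\<Sum>a\<in>advice s. ?p (B a))"
      by (rule measure_pmf.finite_measure_subadditive_finite) (auto simp: finite_advice)
    also have "\<dots> \<le> (\<Sum>a\<in>advice s. inverse \<delta> ^ m * R)"
      unfolding B_def R_def
      by (intro sum_mono prob_many_inverted[OF assms(1-4) _ \<delta>])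
    also have "\<dots> = 2 ^ s * (inverse \<delta> ^ m * R)" by (simp add: card_advice)
    also have "\<dots> \<le> 2 ^ s * (inverse \<delta> ^ m * Q)"
      using RQ \<delta> by (intro mult_left_mono) auto
    finally have "?p ?E \<le> alpha_prob n \<tau> \<delta> + 2 ^ s * inverse \<delta> ^ m * Q"
      by (simp add: alpha_prob_def mult.assoc)
    then have "ereal (?p ?E) \<le> ereal (alpha_prob n \<tau> \<delta> + 2 ^ s * inverse \<delta> ^ m * Q)" by simp
    also have "\<dots> = ereal (alpha_prob n \<tau> \<delta>) + 2 ^ s * inv_power \<delta> m * ereal Q"
    proof -
      have "inv_power \<delta> m = ereal (inverse \<delta> ^ m)"
        using \<delta> by (simp add: inv_power_def)
      then show ?thesis by (simp add: two_power)
    qed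
    finally show ?thesis unfolding Q_def .
  qed
qed

end
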